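(* Let $\mathcal H$ be a real Hilbert space and let $m\geq 1$ be an integer. For every $n\in\mathbb N$ and every $i\in\{1,\ldots,m\}$, let $\alpha_{i,n}\in\,]0,1]$ and let $T_{i,n}\colon\mathcal H\to\mathcal H$ be $\alpha_{i,n}$-averaged nonexpansive if $i<m$, and $\alpha_{m,n}$-averaged quasinonexpansive if $i=m$. For every $n\in\mathbb N$ set $T_n=T_{1,n}\cdots T_{m,n}$ (composition), suppose that $S=\bigcap_{n\in\mathbb N}\operatorname{Fix}T_n\neq\varnothing$, and suppose that one of the following holds: (P1) for every $n\in\mathbb N$, $T_{m,n}$ is $\alpha_{m,n}$-averaged nonexpansive; (P2) $m>1$ and, for every $n\in\mathbb N$, $\alpha_{m,n}<1$ and $\bigcap_{i=1}^m\operatorname{Fix}T_{i,n}\neq\varnothing$; (P3) $m=1$. For every $n\in\mathbb N$, let $\phi_n\in\,]0,1]$ be an averaging constant of $T_n$, let $\lambda_n\in\,]0,1/\phi_n]$ and, for every $i\in\{1,\ldots,m\}$, let $e_{i,n}\in\mathcal H$. Let $(\mu_{n,j})_{n\in\mathbb N,\,0\leq j\leq n}$ be a real array such that: (A1) $\sup_{n\in\mathbb N}\sum_{j=0}^n|\mu_{n,j}|<+\infty$; (A2) for every $n\in\mathbb N$, $\sum_{j=0}^n\mu_{n,j}=1$; (A3) for every $j\in\mathbb N$, $\lim_{n\to+\infty}\mu_{n,j}=0$; (A4) $(\chi_n)_{n\in\mathbb N}$ is a sequence in $]0,+\infty[$ such that $\inf_{n\in\mathbb N}\chi_n>0$ and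 every sequence $(\xi_n)_{n\in\mathbb N}$ in $[0,+\infty[$ for which there exists a sequence $(\varepsilon_n)_{n\in\mathbb N}$ in $[0,+\infty[$ with $\sum_{n\in\mathbb N}\chi_n\varepsilon_n<+\infty$ and $\xi_{n+1}\leq\sum_{j=0}^n\mu_{n,j}\xi_j+\varepsilon_n$ for all $n\in\mathbb N$, converges. Let $x_0\in\mathcal H$ and, for every $n\in\mathbb N$, set $$\overline x_n=\sum_{j=0}^n\mu_{n,j}x_j,$$ $$x_{n+1}=\overline x_n+\lambda_n\Big(T_{1,n}\Big(T_{2,n}\big(\cdots T_{m-1,n}(T_{m,n}\overline x_n+e_{m,n})+e_{m-1,n}\cdots\big)+e_{2,n}\Big)+e_{1,n}-\overline x_n\Big).$$ For every $n\in\mathbb N$, define $\vartheta_n=\lambda_n\sum_{i=1}^m\|e_{i,n}\|$; for every $i\in\{1,\ldots,m\}$, define $T_{i+,n}=T_{i+1,n}\cdots T_{m,n}$ if $i\neq m$ and $T_{i+,n}=\operatorname{Id}$ if $i=m$; and define $\nu_n\colon S\to[0,+\infty[$ by $\nu_n(x)=\vartheta_n(2\|\overline x_n-x\|+\vartheta_n)$. Then the following hold: (i) For every $n\in\mathbb N$ and $x\in S$, $\|x_{n+1}-x\|\leq\sum_{j=0}^n|\mu_{n,j}|\,\|x_j-x\|+\vartheta_n$. (ii) For every $n\in\mathbb N$ and $x\in S$, $$\|x_{n+1}-x\|^2\leq\sum_{j=0}^n\mu_{n,j}\|x_j-x\|^2-\frac12\sum_{j=0}^n\sum_{k=0}^n\mu_{n,j}\mu_{n,k}\|x_j-x_k\|^2-\lambda_n(1/\phi_n-\lambda_n)\|T_n\overline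 x_n-\overline x_n\|^2+\nu_n(x).$$ (iii) For every $n\in\mathbb N$ and $x\in S$, $$\begin{aligned}\|x_{n+1}-x\|^2\leq{}&\sum_{j=0}^n\mu_{n,j}\|x_j-x\|^2-\frac12\sum_{j=0}^n\sum_{k=0}^n\mu_{n,j}\mu_{n,k}\|x_j-x_k\|^2+\lambda_n(\lambda_n-1)\|T_n\overline x_n-\overline x_n\|^2\\&-\lambda_n\max_{1\leq i\leq m}\Big(\frac{1-\alpha_{i,n}}{\alpha_{i,n}}\big\|(\operatorname{Id}-T_{i,n})T_{i+,n}\overline x_n-(\operatorname{Id}-T_{i,n})T_{i+,n}x\big\|^2\Big)+\nu_n(x).\end{aligned}$$ Now assume that, in addition, $$\sum_{n\in\mathbb N}\chi_n\sum_{j=0}^n\sum_{k=0}^n[\mu_{n,j}\mu_{n,k}]^-\|x_j-x_k\|^2<+\infty\quad\text{and}\quad(\forall x\in S)\ \ \sum_{n\in\mathbb N}\chi_n\nu_n(x)<+\infty.$$ Then the following hold: (iv) For every $x\in S$, $(\|x_n-x\|)_{n\in\mathbb N}$ converges. (v) $\lambda_n(1/\phi_n-\lambda_n)\|T_n\overline x_n-\overline x_n\|^2\to 0$. (vi) $\sum_{j=0}^n\sum_{k=0}^n[\mu_{n,j}\mu_{n,k}]^+\|x_j-x_k\|^2\to 0$. (vii) Suppose that there exists $\varepsilon\in\,]0,1[$ such that $\lambda_n\leq(1-\varepsilon)/\phi_n$ for all $n\in\mathbb N$. Then $x_{n+1}-\overline x_n\to 0$. In addition, if every weak sequential cluster point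 of $(\overline x_n)_{n\in\mathbb N}$ is in $S$, then there exists $x\in S$ such that $x_n\rightharpoonup x$. (viii) Suppose that $(\overline x_n)_{n\in\mathbb N}$ has a strong cluster point $x$ in $S$ and that there exists $\varepsilon\in\,]0,1[$ such that $\lambda_n\leq(1-\varepsilon)/\phi_n$ for all $n\in\mathbb N$. Then $x_n\to x$. (ix) Let $x\in S$ and suppose that there exists $\varepsilon\in\,]0,1[$ such that $\lambda_n\leq\varepsilon+(1-\varepsilon)/\phi_n$ for all $n\in\mathbb N$. Then $$\lambda_n\max_{1\leq i\leq m}\frac{1-\alpha_{i,n}}{\alpha_{i,n}}\big\|(\operatorname{Id}-T_{i,n})T_{i+,n}\overline x_n-(\operatorname{Id}-T_{i,n})T_{i+,n}x\big\|^2\to 0.$$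
   Context: $\mathbb N=\{0,1,2,\ldots\}$. $\operatorname{Fix}T=\{x\in\mathcal H: Tx=x\}$; $\operatorname{Id}$ is the identity operator; $\rightharpoonup$ and $\to$ denote weak and strong convergence. For $\xi\in\mathbb R$, $[\xi]^+=\max\{0,\xi\}$ and $[\xi]^-=-\min\{0,\xi\}$. An operator $T\colon\mathcal H\to\mathcal H$ is nonexpansive if it is $1$-Lipschitzian, and quasinonexpansive if $\|Tx-y\|\leq\|x-y\|$ for all $x\in\mathcal H$ and all $y\in\operatorname{Fix}T$. For $\alpha\in\,]0,1]$, $T$ is $\alpha$-averaged nonexpansive if $T=(1-\alpha)\operatorname{Id}+\alpha R$ for some nonexpansive $R\colon\mathcal H\to\mathcal H$, and $\alpha$-averaged quasinonexpansive if the operator $(1-1/\alpha)\operatorname{Id}+(1/\alpha)T$ is quasinonexpansive. "$\phi_n$ is an averaging constant of $T_n$" means that $T_n$ is $\phi_n$-averaged quasinonexpansive. *)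

theory Defs
  imports "HOL-Analysis.Analysis"
begin

definition Fix :: "('a \<Rightarrow> 'a) \<Rightarrow> 'a set" where
  "Fix T = {x. T x = x}"

definition nonexpansive :: "('a::real_inner \<Rightarrow> 'a) \<Rightarrow> bool" where
  "nonexpansive T \<longleftrightarrow> 1-lipschitz_on UNIV T"

definition quasinonexpansive :: "('a::real_inner \<Rightarrow> 'a) \<Rightarrow> bool" where
  "quasinonexpansive T \<longleftrightarrow> (\<forall>x. \<forall>y\<in>Fix T. norm (T x - y) \<le> norm (x - y))"

definition averaged_nonexpansive :: "real \<Rightarrow> ('a::real_inner \<Rightarrow> 'a) \<Rightarrow> bool" where
  "averaged_nonexpansive \<alpha> T \<longleftrightarrow> 0 < \<alpha> \<and> \<alpha> \<le> 1 \<and>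
     (\<exists>R. nonexpansive R \<and> T = (\<lambda>x. (1 - \<alpha>) *\<^sub>R x + \<alpha> *\<^sub>R R x))"

definition averaged_quasinonexpansive :: "real \<Rightarrow> ('a::real_inner \<Rightarrow> 'a) \<Rightarrow> bool" where
  "averaged_quasinonexpansive \<alpha> T \<longleftrightarrow> 0 < \<alpha> \<and> \<alpha> \<le> 1 \<and>
     quasinonexpansive (\<lambda>x. (1 - 1 / \<alpha>) *\<^sub>R x + (1 / \<alpha>) *\<^sub>R T x)"

(* T p \<circ> T (p+1) \<circ> ... \<circ> T q, with T q applied first; the identity if q < p. *)
definition compose_ops :: "(nat \<Rightarrow> 'a \<Rightarrow> 'a) \<Rightarrow> nat \<Rightarrow> nat \<Rightarrow> 'a \<Rightarrow> 'a" where
  "compose_ops T p q = foldr (\<lambda>i f. T i \<circ> f) [p..<Suc q] id"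

(* T 1 (T 2 (... (T m y + e m) ...) + e 2) + e 1: the error e i is added to the
   output of T i, before T (i-1) is applied. *)
definition perturbed_compose ::
    "(nat \<Rightarrow> 'a \<Rightarrow> 'a) \<Rightarrow> (nat \<Rightarrow> 'a) \<Rightarrow> nat \<Rightarrow> 'a \<Rightarrow> 'a::real_inner" where
  "perturbed_compose T e m y = foldr (\<lambda>i z. T i z + e i) [1..<Suc m] y"

(* Weak convergence in a Hilbert space, whose weak topology is the coarsest one that makes
   all the functionals \<open>\<lambda>z. z \<bullet> u\<close> continuous. *)
definition weakly_converges :: "(nat \<Rightarrow> 'a::real_inner) \<Rightarrow> 'a \<Rightarrow> bool" where
  "weakly_converges x l \<longleftrightarrow> (\<forall>u. (\<lambda>n. x n \<bullet> u) \<longlonglongrightarrow> l \<bullet> u)"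

definition weak_sequential_cluster_point :: "(nat \<Rightarrow> 'a::real_inner) \<Rightarrow> 'a \<Rightarrow> bool" where
  "weak_sequential_cluster_point x l \<longleftrightarrow>
     (\<exists>r. strict_mono r \<and> weakly_converges (x \<circ> r) l)"

definition strong_cluster_point :: "(nat \<Rightarrow> 'a::real_inner) \<Rightarrow> 'a \<Rightarrow> bool" where
  "strong_cluster_point x l \<longleftrightarrow> (\<exists>r. strict_mono r \<and> (x \<circ> r) \<longlonglongrightarrow> l)"

definition pos_part :: "real \<Rightarrow> real" where
  "pos_part \<xi> = max 0 \<xi>"

definition neg_part :: "real \<Rightarrow> real" where
  "neg_part \<xi> = - min 0 \<xi>"

end

theory Submission
  imports Defs
begin

text \<open>At a fixed step, write \<open>z = xbar n\<close> and \<open>w = z + lam n *\<^sub>R (Tn n z - z)\<close> for the error-free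
update.  The next iterate differs from \<open>w\<close> by at most \<open>\<theta> n\<close>, because every operator that an
error passes through is nonexpansive (\<open>perturbed_compose_error\<close>).  The error-free step is a
relaxation of a quasinonexpansive operator, so it does not move \<open>z\<close> away from any \<open>y \<in> S\<close>, and
the gain in squared distance is at least an explicit multiple of the squared residual
(\<open>averaged_quasinonexpansive_relaxation_norm_sq_le\<close>).  The squared distance from the affine
combination \<open>z\<close> to \<open>y\<close> is the average of the squared distances of the \<open>x j\<close>, minus their
weighted variance (\<open>norm_sq_affine_sum\<close>); the weights may be negative, so this is an identity
and not a convexity estimate.  Expanding the square of \<open>norm (w - y) + \<theta> n\<close> then gives the
estimate with the residual.  For the estimate with the maximum, the inequalities for the
individual operators are telescoped along the composition (\<open>compose_ops_norm_sq_le_Max\<close>).  If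
the innermost operator is only quasinonexpansive, \<open>y\<close> has to be one of its fixed points; for \<open>m > 1\<close>,
\<open>fixed_point_of_innermost\<close> extracts this from a common fixed point and strictness of its averaging
constant.

For the asymptotic statements, the positive part of the variance is moved to the gains and the
negative part to the errors.  The squared distances to \<open>y\<close> then satisfy the recursion for which
convergence is assumed.  Since the array \<open>\<mu>\<close> is regular in the sense of Toeplitz, the averages of a
convergent sequence have the same limit as the sequence itself; hence everything that has been
gained in the recursion tends to zero (\<open>residual_tendsto_0\<close>).  Applied to the three kinds of gain,
this yields the limits of the residual, of the positive part of the variance, and of the maximum.
The bound \<open>lam n \<le> (1 - \<epsilon>) / \<phi> n\<close> makes the residual gain control the increment
\<open>x (Suc n) - xbar n\<close>, so that both sequences have the same cluster points.  Strong convergence is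
then immediate, and weak convergence is Opial's argument (\<open>opial\<close>), whose compactness input is the
weak sequential compactness of bounded sets in a Hilbert space
(\<open>bounded_imp_weakly_convergent_subsequence\<close>).\<close>

section \<open>Weak compactness and Opial's argument in Hilbert spaces\<close>

lemma norm_sq_affine_combination:
  fixes a b :: "'a::real_inner"
  shows "(norm ((1 - k) *\<^sub>R a + k *\<^sub>R b))\<^sup>2
    = (1 - k) * (norm a)\<^sup>2 + k * (norm b)\<^sup>2 - k * (1 - k) * (norm (a - b))\<^sup>2"
  unfolding power2_norm_eq_inner
  by (simp add: inner_add_left inner_add_right inner_diff_left inner_diff_right inner_commute algebra_simps)

text \<open>Completeness replaces the local compactness used in Euclidean space.  By the parallelogram identity,
the points of \<open>C\<close> that are nearly as close to \<open>u\<close> as possible form a set of small diameter: the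
midpoint of two of them is again in \<open>C\<close> and would otherwise be too close.  Nested closed sets with
diameters tending to zero have a common point.\<close>

lemma closest_point_exists_hilbert:
  fixes C :: "'a::{real_inner, complete_space} set"
  assumes "closed C" "convex C" "C \<noteq> {}"
  obtains p where "p \<in> C" "\<forall>c\<in>C. dist u p \<le> dist u c"
proof -
  define d where "d = infdist u C"
  have d0: "d \<ge> 0" by (simp add: d_def infdist_nonneg)
  have d_le: "d \<le> dist u c" if "c \<in> C" for c
    using that by (simp add: d_def infdist_le)
  define B where "B n = C \<inter> cball u (d + 1 / real (Suc n))" for n
  have "\<exists>p. \<forall>n. p \<in> B n"
  proof (rule decreasing_closed_nest)
    show "closed (B n)" for n using assms(1) by (auto simp: B_def)
    show "B n \<noteq> {}" for n
    proof -
      have "infdist u C < d + 1 / real (Suc n)" by (simp add: d_def)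
      then obtain c where "c \<in> C" "dist u c < d + 1 / real (Suc n)"
        unfolding infdist_notempty[OF assms(3)] using assms(3) by (auto simp: cINF_less_iff)
      then show ?thesis by (force simp: B_def)
    qed
    show "B n \<subseteq> B k" if "k \<le> n" for k n
    proof -
      have "1 / real (Suc n) \<le> 1 / real (Suc k)"
        using that by (intro divide_left_mono) auto
      then show ?thesis unfolding B_def by (intro Int_mono subset_refl subset_cball add_left_mono)
    qed
    show "\<exists>n. \<forall>x\<in>B n. \<forall>y\<in>B n. dist x y < e" if "e > 0" for e
    proof -
      have "(\<lambda>n. 4 * ((d + 1 / real (Suc n))\<^sup>2 - d\<^sup>2)) \<longlonglongrightarrow> 4 * ((d + 0)\<^sup>2 - d\<^sup>2)"
        by (intro tendsto_intros LIMSEQ_Suc[OF lim_1_over_n])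
      then have "eventually (\<lambda>n. 4 * ((d + 1 / real (Suc n))\<^sup>2 - d\<^sup>2) < e\<^sup>2) sequentially"
        using \<open>e > 0\<close> by (intro order_tendstoD) auto
      then obtain n where n: "4 * ((d + 1 / real (Suc n))\<^sup>2 - d\<^sup>2) < e\<^sup>2"
        by (auto simp: eventually_sequentially)
      have "dist x y < e" if "x \<in> B n" "y \<in> B n" for x y
      proof -
        have xy: "x \<in> C" "y \<in> C" "norm (u - x) \<le> d + 1 / real (Suc n)" "norm (u - y) \<le> d + 1 / real (Suc n)"
          using that by (auto simp: B_def dist_norm)
        have mid: "(1/2) *\<^sub>R x + (1/2) *\<^sub>R y \<in> C"
          using convexD[OF assms(2) xy(1,2), of "1/2" "1/2"] by simp
        \<comment> \<open>The coefficient \<open>1 - 1/2\<close> is the form in which the identity for two points applies.\<close>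
        have half: "(1 - 1/2) *\<^sub>R (u - x) + (1/2) *\<^sub>R (u - y) = u - ((1/2) *\<^sub>R x + (1/2) *\<^sub>R y)"
          by (simp add: algebra_simps flip: scaleR_add_left)
        have "d\<^sup>2 \<le> (norm (u - ((1/2) *\<^sub>R x + (1/2) *\<^sub>R y)))\<^sup>2"
          using d_le[OF mid] d0 by (intro power_mono) (auto simp: dist_norm)
        also have "\<dots> = (1/2) * (norm (u - x))\<^sup>2 + (1/2) * (norm (u - y))\<^sup>2 - (1/4) * (norm (x - y))\<^sup>2"
          using norm_sq_affine_combination[of "1/2" "u - x" "u - y"]
          unfolding half by (simp add: norm_minus_commute)
        finally have "(norm (x - y))\<^sup>2 \<le> 2 * (norm (u - x))\<^sup>2 + 2 * (norm (u - y))\<^sup>2 - 4 * d\<^sup>2"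
          by simp
        moreover have "(norm (u - x))\<^sup>2 \<le> (d + 1 / real (Suc n))\<^sup>2" "(norm (u - y))\<^sup>2 \<le> (d + 1 / real (Suc n))\<^sup>2"
          using xy by (auto intro: power_mono)
        ultimately have "(norm (x - y))\<^sup>2 < e\<^sup>2" using n by simp
        then show ?thesis
          using \<open>e > 0\<close> by (simp add: dist_norm power_less_imp_less_base)
      qed
      then show ?thesis by blast
    qed
  qed blast
  then obtain p where p: "\<And>n. p \<in> C" "\<And>n. dist u p \<le> d + 1 / real (Suc n)"
    by (auto simp: B_def)
  have "(\<lambda>n. d + 1 / real (Suc n)) \<longlonglongrightarrow> d + 0"
    by (intro tendsto_intros LIMSEQ_Suc[OF lim_1_over_n])
  then have "dist u p \<le> d + 0"
    using p(2) by (intro LIMSEQ_le_const) auto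
  then show thesis using that p(1) d_le by (metis add.right_neutral order_trans)
qed

lemma orthogonal_projection_exists:
  fixes W :: "'a::{real_inner, complete_space} set"
  assumes "closed W" "subspace W"
  obtains p where "p \<in> W" "\<forall>w\<in>W. (u - p) \<bullet> w = 0"
proof -
  have conv: "convex W" and ne: "W \<noteq> {}"
    using assms(2) subspace_imp_convex subspace_0 by auto
  obtain p where p: "p \<in> W" "\<forall>c\<in>W. dist u p \<le> dist u c"
    using closest_point_exists_hilbert[OF assms(1) conv ne] by blast
  have "(u - p) \<bullet> w = 0" if "w \<in> W" for w
  proof -
    have "p + w \<in> W" "p - w \<in> W"
      using assms(2) p(1) that by (auto intro: subspace_add subspace_diff)
    then have "(u - p) \<bullet> ((p + w) - p) \<le> 0" "(u - p) \<bullet> ((p - w) - p) \<le> 0"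
      using any_closest_point_dot[OF conv assms(1) p(1) _ p(2)] by blast+
    then show ?thesis by simp
  qed
  then show thesis using that p(1) by blast
qed

text \<open>A vector orthogonal to the kernel of \<open>f\<close>, rescaled, represents \<open>f\<close>, because the kernel has
codimension one.\<close>

lemma riesz_representation:
  fixes f :: "'a::{real_inner, complete_space} \<Rightarrow> real"
  assumes "bounded_linear f"
  obtains p where "\<And>u. f u = p \<bullet> u"
proof (cases "\<forall>u. f u = 0")
  case True
  then show thesis by (intro that[of 0]) simp
next
  case False
  then obtain w where w: "f w \<noteq> 0" by blast
  interpret f: bounded_linear f by fact
  define K where "K = {u. f u = 0}"
  have "closed K"
    unfolding K_def by (intro closed_Collect_eq continuous_intros f.continuous_on)
  moreover have "subspace K"
    by (auto simp: K_def subspace_def f.add f.scaleR)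
  ultimately obtain q where q: "q \<in> K" "\<forall>k\<in>K. (w - q) \<bullet> k = 0"
    using orthogonal_projection_exists by blast
  define v where "v = w - q"
  have fv: "f v = f w" using q(1) by (simp add: v_def f.diff K_def)
  then have "v \<noteq> 0" using w f.zero by auto
  have "f u = ((f v / (v \<bullet> v)) *\<^sub>R v) \<bullet> u" for u
  proof -
    have "u - (f u / f v) *\<^sub>R v \<in> K"
      using w fv by (simp add: K_def f.diff f.scaleR)
    then have "v \<bullet> (u - (f u / f v) *\<^sub>R v) = 0" using q(2) by (simp add: v_def)
    then have "v \<bullet> u = (f u / f v) * (v \<bullet> v)" by (simp add: inner_diff)
    then show ?thesis using \<open>v \<noteq> 0\<close> w fv by simp
  qed
  then show thesis using that by blast
qed

text \<open>Cantor's diagonal argument, obtained from Tychonoff's theorem: a product of compact intervals over a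
countable index set is compact and first countable, hence sequentially compact.\<close>

lemma diagonal_subsequence_real:
  fixes F :: "nat \<Rightarrow> nat \<Rightarrow> real"
  assumes "\<And>k j. \<bar>F k j\<bar> \<le> B j"
  obtains r :: "nat \<Rightarrow> nat" where "strict_mono r" "\<And>j. convergent (\<lambda>k. F (r k) j)"
proof -
  have "compact (PiE UNIV (\<lambda>j. cball (0::real) (B j)))"
    using compactin_PiE[of "\<lambda>_. euclideanreal" UNIV "\<lambda>j. cball 0 (B j)"]
    by (simp add: euclidean_product_topology)
  then have "seq_compact (PiE UNIV (\<lambda>j. cball (0::real) (B j)))"
    by (rule compact_imp_seq_compact)
  moreover have "\<forall>k. F k \<in> PiE UNIV (\<lambda>j. cball 0 (B j))"
    using assms by auto
  ultimately obtain l r where r: "strict_mono r" "(F \<circ> r) \<longlonglongrightarrow> l"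
    unfolding seq_compact_def by blast
  have "(\<lambda>k. F (r k) j) \<longlonglongrightarrow> l j" for j
    using continuous_on_tendsto_compose[OF continuous_on_product_coordinates r(2)]
    by (simp add: o_def)
  then show thesis using that r(1) by (auto simp: convergent_def)
qed

text \<open>A diagonal subsequence makes the inner products with every \<open>x j\<close> converge.  The vectors for which
they converge form a closed subspace, and the inner products with vectors orthogonal to all \<open>x j\<close>
vanish; by orthogonal projection they converge for every vector, even if the space is not
separable.  The limit is a bounded functional, and its Riesz vector is the weak limit.\<close>

lemma bounded_imp_weakly_convergent_subsequence:
  fixes x :: "nat \<Rightarrow> 'a::{real_inner, complete_space}"
  assumes "bounded (range x)"
  obtains r l where "strict_mono (r::nat \<Rightarrow> nat)" "weakly_converges (x \<circ> r) l"
proof -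
  obtain M where M: "\<And>n. norm (x n) \<le> M"
    using assms by (auto simp: bounded_iff)
  have M0: "M \<ge> 0" using M[of 0] norm_ge_zero order_trans by blast
  have "\<bar>x k \<bullet> x j\<bar> \<le> M * M" for k j
    using Cauchy_Schwarz_ineq2[of "x k" "x j"] mult_mono[OF M[of k] M[of j]] M0 by simp
  then obtain r where r: "strict_mono r" "\<And>j. convergent (\<lambda>k. x (r k) \<bullet> x j)"
    using diagonal_subsequence_real[of "\<lambda>k j. x k \<bullet> x j" "\<lambda>_. M * M"] by blast
  define D where "D = {u. convergent (\<lambda>k. x (r k) \<bullet> u)}"
  have sub: "subspace D"
    by (auto simp: D_def subspace_def inner_add_right convergent_const
        intro: convergent_add convergent_mult)
  have "closed D"
    unfolding closed_sequential_limits
  proof (intro allI impI)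
    fix u l assume A: "(\<forall>n. u n \<in> D) \<and> u \<longlonglongrightarrow> l"
    have "Cauchy (\<lambda>k. x (r k) \<bullet> l)"
    proof (rule metric_CauchyI)
      fix e :: real assume e: "e > 0"
      then have "e / (3 * (M + 1)) > 0" using M0 by simp
      then obtain n where n: "norm (u n - l) < e / (3 * (M + 1))"
        using A by (metis LIMSEQ_iff order_refl)
      have close: "\<bar>x k \<bullet> l - x k \<bullet> u n\<bar> < e / 3" for k
      proof -
        have "\<bar>x k \<bullet> l - x k \<bullet> u n\<bar> \<le> norm (x k) * norm (u n - l)"
          using Cauchy_Schwarz_ineq2[of "x k" "l - u n"]
          by (simp add: inner_diff_right norm_minus_commute)
        also have "\<dots> \<le> (M + 1) * norm (u n - l)"
          using M[of k] by (intro mult_right_mono) auto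
        also have "\<dots> < (M + 1) * (e / (3 * (M + 1)))"
          using n M0 by (intro mult_strict_left_mono) auto
        also have "\<dots> = e / 3" using M0 by (simp add: add_nonneg_eq_0_iff divide_simps)
        finally show ?thesis .
      qed
      have "Cauchy (\<lambda>k. x (r k) \<bullet> u n)"
        using A by (auto simp: D_def intro: convergent_Cauchy)
      then obtain N where N: "\<And>i j. i \<ge> N \<Longrightarrow> j \<ge> N \<Longrightarrow> dist (x (r i) \<bullet> u n) (x (r j) \<bullet> u n) < e / 3"
        using e metric_CauchyD[of "\<lambda>k. x (r k) \<bullet> u n" "e / 3"] by auto
      have "dist (x (r i) \<bullet> l) (x (r j) \<bullet> l) < e" if "i \<ge> N" "j \<ge> N" for i j
        using N[OF that] close[of "r i"] close[of "r j"]
        unfolding dist_real_def by linarith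
      then show "\<exists>N. \<forall>i\<ge>N. \<forall>j\<ge>N. dist (x (r i) \<bullet> l) (x (r j) \<bullet> l) < e" by blast
    qed
    then show "l \<in> D" by (simp add: D_def Cauchy_convergent_iff)
  qed
  have in_D: "u \<in> D" for u
  proof -
    obtain p where p: "p \<in> D" "\<forall>w\<in>D. (u - p) \<bullet> w = 0"
      using orthogonal_projection_exists[OF \<open>closed D\<close> sub] by blast
    have "x (r k) \<bullet> u = x (r k) \<bullet> p" for k
      using p(2) r(2) by (metis D_def inner_commute inner_diff_left mem_Collect_eq right_minus_eq)
    then show ?thesis using p(1) by (simp add: D_def)
  qed
  define f where "f u = lim (\<lambda>k. x (r k) \<bullet> u)" for u
  have f: "(\<lambda>k. x (r k) \<bullet> u) \<longlonglongrightarrow> f u" for u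
    using in_D by (simp add: D_def f_def convergent_LIMSEQ_iff)
  have "bounded_linear f"
  proof (rule bounded_linear_intro)
    show "f (u + v) = f u + f v" for u v
      using tendsto_add[OF f f, of u v] f[of "u + v"]
      by (simp add: inner_add_right LIMSEQ_unique)
    show "f (c *\<^sub>R u) = c *\<^sub>R f u" for c u
      using tendsto_mult[OF tendsto_const[of c] f, of u] f[of "c *\<^sub>R u"]
      by (simp add: LIMSEQ_unique)
    show "norm (f u) \<le> norm u * M" for u
    proof (rule LIMSEQ_le_const2[OF tendsto_norm[OF f]])
      have "norm (x (r k) \<bullet> u) \<le> norm u * M" for k
        using Cauchy_Schwarz_ineq2[of "x (r k)" u] mult_right_mono[OF M[of "r k"], of "norm u"]
        by (simp add: mult.commute)
      then show "\<exists>N. \<forall>k\<ge>N. norm (x (r k) \<bullet> u) \<le> norm u * M" by blast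
    qed
  qed
  then obtain p where "\<And>u. f u = p \<bullet> u" using riesz_representation by blast
  then have "weakly_converges (x \<circ> r) p"
    using f by (simp add: weakly_converges_def)
  then show thesis using that r(1) by blast
qed

text \<open>The point is that two weak cluster points \<open>y\<close> and \<open>z\<close> in \<open>S\<close> coincide: the difference of the
squared distances to \<open>y\<close> and \<open>z\<close> converges and is affine in \<open>x n\<close>, so \<open>x n \<bullet> (y - z)\<close> converges,
and its limit can be computed along either subsequence.  Weak compactness of the bounded sequence then
upgrades a unique cluster point to a weak limit.\<close>

lemma opial:
  fixes x :: "nat \<Rightarrow> 'a::{real_inner, complete_space}"
  assumes "S \<noteq> {}"
    and conv: "\<And>y. y \<in> S \<Longrightarrow> convergent (\<lambda>n. norm (x n - y))"
    and clus: "\<And>y. weak_sequential_cluster_point x y \<Longrightarrow> y \<in> S"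
  obtains y where "y \<in> S" "weakly_converges x y"
proof -
  obtain s where "s \<in> S" using assms(1) by blast
  have "Bseq (\<lambda>n. norm (x n - s))"
    using conv[OF \<open>s \<in> S\<close>] by (rule convergent_imp_Bseq)
  then have "bounded (range (\<lambda>n. (x n - s) + s))"
    by (intro bounded_plus_comp) (auto simp: Bseq_eq_bounded bounded_iff)
  then have bdd: "bounded (range x)" by simp
  have unique: "y = z"
    if yz: "weak_sequential_cluster_point x y" "weak_sequential_cluster_point x z" for y z
  proof -
    have eq: "x n \<bullet> (y - z) = ((norm (x n - z))\<^sup>2 - (norm (x n - y))\<^sup>2 + y \<bullet> y - z \<bullet> z) / 2" for n
      by (simp add: power2_norm_eq_inner inner_diff inner_commute)
    have "convergent (\<lambda>n. x n \<bullet> (y - z))"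
      unfolding eq
      using conv[OF clus[OF yz(1)]] conv[OF clus[OF yz(2)]]
      unfolding convergent_def by (force intro!: tendsto_intros)
    then obtain c where c: "(\<lambda>n. x n \<bullet> (y - z)) \<longlonglongrightarrow> c" by (auto simp: convergent_def)
    have "w \<bullet> (y - z) = c" if w: "weak_sequential_cluster_point x w" for w
    proof -
      obtain r where r: "strict_mono r" "weakly_converges (x \<circ> r) w"
        using w by (auto simp: weak_sequential_cluster_point_def)
      then show ?thesis
        using LIMSEQ_subseq_LIMSEQ[OF c r(1)]
        by (auto simp: weakly_converges_def o_def intro: LIMSEQ_unique)
    qed
    then have "y \<bullet> (y - z) = z \<bullet> (y - z)" using yz by simp
    then have "(y - z) \<bullet> (y - z) = 0" by (simp add: inner_diff_left)
    then show ?thesis by simp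
  qed
  obtain r y where r: "strict_mono r" "weakly_converges (x \<circ> r) y"
    using bounded_imp_weakly_convergent_subsequence[OF bdd] by blast
  then have y: "weak_sequential_cluster_point x y"
    by (auto simp: weak_sequential_cluster_point_def)
  have "(\<lambda>n. x n \<bullet> u) \<longlonglongrightarrow> y \<bullet> u" for u
  proof (rule ccontr)
    assume "\<not> ?thesis"
    then obtain e where "e > 0" and "\<not> (\<forall>\<^sub>F n in sequentially. dist (x n \<bullet> u) (y \<bullet> u) < e)"
      by (auto simp: tendsto_iff)
    then have "infinite {n. \<not> dist (x n \<bullet> u) (y \<bullet> u) < e}"
      by (simp add: not_eventually frequently_cofinite flip: cofinite_eq_sequentially)
    then obtain q :: "nat \<Rightarrow> nat" where q: "strict_mono q" "\<And>n. \<not> dist (x (q n) \<bullet> u) (y \<bullet> u) < e"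
      using infinite_enumerate by blast
    have "bounded (range (x \<circ> q))" using bdd by (rule bounded_subset) auto
    then obtain r' z where r': "strict_mono r'" "weakly_converges ((x \<circ> q) \<circ> r') z"
      using bounded_imp_weakly_convergent_subsequence by blast
    then have "weak_sequential_cluster_point x z"
      unfolding weak_sequential_cluster_point_def
      using strict_mono_o[OF q(1) r'(1)] by (metis comp_assoc)
    then have "z = y" using unique y by blast
    then have "(\<lambda>k. x (q (r' k)) \<bullet> u) \<longlonglongrightarrow> y \<bullet> u"
      using r'(2) by (simp add: weakly_converges_def)
    then have "\<forall>\<^sub>F k in sequentially. dist (x (q (r' k)) \<bullet> u) (y \<bullet> u) < e"
      using \<open>e > 0\<close> by (rule tendstoD)
    then show False using q(2) by (auto simp: eventually_sequentially)
  qed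
  then show thesis using that clus[OF y] by (simp add: weakly_converges_def)
qed

section \<open>Affine averages and Toeplitz arrays\<close>

text \<open>When \<open>(norm (x j - x k))\<^sup>2\<close> is expanded around \<open>y\<close>, the weights add up to one, so the square
terms reproduce the average of the squared distances to \<open>y\<close> twice and the mixed terms assemble to
the square on the left-hand side.\<close>

lemma norm_sq_affine_sum:
  fixes x :: "'i \<Rightarrow> 'a::real_inner"
  assumes sum1: "(\<Sum>j\<in>A. c j) = 1"
  shows "(norm ((\<Sum>j\<in>A. c j *\<^sub>R x j) - y))\<^sup>2
    = (\<Sum>j\<in>A. c j * (norm (x j - y))\<^sup>2)
      - 1 / 2 * (\<Sum>j\<in>A. \<Sum>k\<in>A. c j * c k * (norm (x j - x k))\<^sup>2)"
proof -
  define a where "a j = x j - y" for j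
  have shift: "(\<Sum>j\<in>A. c j *\<^sub>R x j) - y = (\<Sum>j\<in>A. c j *\<^sub>R a j)"
    using sum1 by (simp add: a_def scaleR_diff_right sum_subtractf flip: scaleR_left.sum)
  have cross: "c j * c k * (norm (x j - x k))\<^sup>2
      = c k * (c j * (norm (a j))\<^sup>2) + c j * (c k * (norm (a k))\<^sup>2) - 2 * (c j * c k * (a j \<bullet> a k))" for j k
  proof -
    have "(norm (x j - x k))\<^sup>2 = (norm (a j - a k))\<^sup>2" by (simp add: a_def)
    also have "\<dots> = (norm (a j))\<^sup>2 + (norm (a k))\<^sup>2 - 2 * (a j \<bullet> a k)"
      by (simp add: power2_norm_eq_inner inner_diff inner_commute)
    finally have "c j * c k * (norm (x j - x k))\<^sup>2
        = c j * c k * ((norm (a j))\<^sup>2 + (norm (a k))\<^sup>2 - 2 * (a j \<bullet> a k))" by simp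
    then show ?thesis by (simp only: algebra_simps)
  qed
  have "(\<Sum>j\<in>A. \<Sum>k\<in>A. c k * (c j * (norm (a j))\<^sup>2)) = (\<Sum>j\<in>A. c j * (norm (a j))\<^sup>2)"
    using sum1 by (simp flip: sum_distrib_right)
  moreover have "(\<Sum>j\<in>A. \<Sum>k\<in>A. c j * (c k * (norm (a k))\<^sup>2)) = (\<Sum>j\<in>A. c j * (norm (a j))\<^sup>2)"
    using sum1 by (simp flip: sum_distrib_left sum_distrib_right)
  moreover have "(norm (\<Sum>j\<in>A. c j *\<^sub>R a j))\<^sup>2 = (\<Sum>j\<in>A. \<Sum>k\<in>A. c j * c k * (a j \<bullet> a k))"
    by (simp add: power2_norm_eq_inner inner_sum_left inner_sum_right sum_distrib_left
        ac_simps inner_commute)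
  moreover have "(\<Sum>j\<in>A. \<Sum>k\<in>A. c j * c k * (norm (x j - x k))\<^sup>2)
      = (\<Sum>j\<in>A. \<Sum>k\<in>A. c k * (c j * (norm (a j))\<^sup>2))
        + (\<Sum>j\<in>A. \<Sum>k\<in>A. c j * (c k * (norm (a k))\<^sup>2))
        - 2 * (\<Sum>j\<in>A. \<Sum>k\<in>A. c j * c k * (a j \<bullet> a k))"
    by (simp only: cross sum.distrib sum_subtractf sum_distrib_left)
  moreover have "(\<Sum>j\<in>A. c j * (norm (x j - y))\<^sup>2) = (\<Sum>j\<in>A. c j * (norm (a j))\<^sup>2)"
    by (simp only: a_def)
  ultimately show ?thesis
    unfolding shift by linarith
qed

text \<open>The head of the sum vanishes in the limit because each column of \<open>\<mu>\<close> tends to zero, and the tail is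
small because the rows are uniformly bounded in \<open>l\<^sup>1\<close>.\<close>

lemma toeplitz_means_tendsto:
  fixes \<mu> :: "nat \<Rightarrow> nat \<Rightarrow> real"
  assumes A1: "bdd_above (range (\<lambda>n. \<Sum>j=0..n. \<bar>\<mu> n j\<bar>))"
    and A2: "\<And>n. (\<Sum>j=0..n. \<mu> n j) = 1"
    and A3: "\<And>j. (\<lambda>n. \<mu> n j) \<longlonglongrightarrow> 0"
    and lim: "\<xi> \<longlonglongrightarrow> l"
  shows "(\<lambda>n. \<Sum>j=0..n. \<mu> n j * \<xi> j) \<longlonglongrightarrow> l"
proof (rule LIMSEQ_I)
  fix e :: real assume e: "e > 0"
  obtain K where K: "\<And>n. (\<Sum>j=0..n. \<bar>\<mu> n j\<bar>) \<le> K" using A1 by (auto simp: bdd_above_def)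
  have K1: "K \<ge> 1" using K[of 0] A2[of 0] by simp
  then have "e / (2 * K) > 0" using e by simp
  from LIMSEQ_D[OF lim this] obtain N where N: "\<forall>j\<ge>N. norm (\<xi> j - l) < e / (2 * K)"
    by blast
  have "(\<lambda>n. \<Sum>j<N. \<bar>\<mu> n j\<bar> * \<bar>\<xi> j - l\<bar>) \<longlonglongrightarrow> (\<Sum>j<N. \<bar>0\<bar> * \<bar>\<xi> j - l\<bar>)"
    by (intro tendsto_intros A3)
  then have "(\<lambda>n. \<Sum>j<N. \<bar>\<mu> n j\<bar> * \<bar>\<xi> j - l\<bar>) \<longlonglongrightarrow> 0" by simp
  from LIMSEQ_D[OF this half_gt_zero[OF e]] obtain M
    where M: "\<forall>n\<ge>M. norm ((\<Sum>j<N. \<bar>\<mu> n j\<bar> * \<bar>\<xi> j - l\<bar>) - 0) < e / 2"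
    by blast
  have "norm ((\<Sum>j=0..n. \<mu> n j * \<xi> j) - l) < e" if n: "n \<ge> max M N" for n
  proof -
    have split: "{0..n} = {..<N} \<union> {N..n}" "{..<N} \<inter> {N..n} = {}" using n by auto
    have "(\<Sum>j=0..n. \<mu> n j * \<xi> j) - l = (\<Sum>j=0..n. \<mu> n j * (\<xi> j - l))"
      using A2[of n] by (simp add: right_diff_distrib sum_subtractf flip: sum_distrib_right)
    then have "norm ((\<Sum>j=0..n. \<mu> n j * \<xi> j) - l) \<le> (\<Sum>j=0..n. \<bar>\<mu> n j\<bar> * \<bar>\<xi> j - l\<bar>)"
      using sum_abs[of "\<lambda>j. \<mu> n j * (\<xi> j - l)" "{0..n}"] by (simp add: abs_mult)
    also have "\<dots> = (\<Sum>j<N. \<bar>\<mu> n j\<bar> * \<bar>\<xi> j - l\<bar>) + (\<Sum>j=N..n. \<bar>\<mu> n j\<bar> * \<bar>\<xi> j - l\<bar>)"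
      unfolding split(1) using split(2) by (intro sum.union_disjoint) auto
    also have "(\<Sum>j=N..n. \<bar>\<mu> n j\<bar> * \<bar>\<xi> j - l\<bar>) \<le> (\<Sum>j=N..n. \<bar>\<mu> n j\<bar> * (e / (2 * K)))"
      using N by (intro sum_mono mult_left_mono) (auto intro: less_imp_le)
    also have "\<dots> = (\<Sum>j=N..n. \<bar>\<mu> n j\<bar>) * (e / (2 * K))"
      by (rule sum_distrib_right[symmetric])
    also have "\<dots> \<le> K * (e / (2 * K))"
    proof (rule mult_right_mono)
      have "(\<Sum>j=N..n. \<bar>\<mu> n j\<bar>) \<le> (\<Sum>j=0..n. \<bar>\<mu> n j\<bar>)" by (intro sum_mono2) auto
      then show "(\<Sum>j=N..n. \<bar>\<mu> n j\<bar>) \<le> K" using K[of n] by simp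
    qed (use e K1 in auto)
    also have "\<dots> = e / 2" using K1 by simp
    finally show ?thesis using spec[OF M, of n] n by simp
  qed
  then show "\<exists>no. \<forall>n\<ge>no. norm ((\<Sum>j=0..n. \<mu> n j * \<xi> j) - l) < e" by blast
qed

text \<open>Both the average and the next term tend to the limit of \<open>\<xi>\<close>, which leaves no room for a gain \<open>r\<close>
that does not vanish.\<close>

lemma residual_tendsto_0:
  fixes \<mu> :: "nat \<Rightarrow> nat \<Rightarrow> real"
  assumes A1: "bdd_above (range (\<lambda>n. \<Sum>j=0..n. \<bar>\<mu> n j\<bar>))"
    and A2: "\<And>n. (\<Sum>j=0..n. \<mu> n j) = 1"
    and A3: "\<And>j. (\<lambda>n. \<mu> n j) \<longlonglongrightarrow> 0"
    and conv: "convergent \<xi>"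
    and \<epsilon>: "\<epsilon> \<longlonglongrightarrow> 0"
    and r_nonneg: "\<And>n. r n \<ge> 0"
    and ineq: "\<And>n. \<xi> (Suc n) \<le> (\<Sum>j=0..n. \<mu> n j * \<xi> j) - r n + \<epsilon> n"
  shows "r \<longlonglongrightarrow> 0"
proof -
  obtain l where l: "\<xi> \<longlonglongrightarrow> l" using conv by (auto simp: convergent_def)
  have "(\<lambda>n. (\<Sum>j=0..n. \<mu> n j * \<xi> j) - \<xi> (Suc n) + \<epsilon> n) \<longlonglongrightarrow> l - l + 0"
    by (intro tendsto_intros toeplitz_means_tendsto[OF A1 A2 A3 l] LIMSEQ_Suc[OF l] \<epsilon>)
  then have lim: "(\<lambda>n. (\<Sum>j=0..n. \<mu> n j * \<xi> j) - \<xi> (Suc n) + \<epsilon> n) \<longlonglongrightarrow> 0" by simp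
  have "r n \<le> (\<Sum>j=0..n. \<mu> n j * \<xi> j) - \<xi> (Suc n) + \<epsilon> n" for n
    using ineq[of n] by simp
  then show ?thesis
    using r_nonneg by (intro tendsto_sandwich[OF _ _ tendsto_const lim] always_eventually allI)
qed

section \<open>Averaged operators and their compositions\<close>

lemma averaged_nonexpansive_norm_sq_le:
  assumes "averaged_nonexpansive \<alpha> T"
  shows "(norm (T u - T v))\<^sup>2
    \<le> (norm (u - v))\<^sup>2 - (1 - \<alpha>) / \<alpha> * (norm ((u - T u) - (v - T v)))\<^sup>2"
proof -
  obtain R where \<alpha>: "0 < \<alpha>" "\<alpha> \<le> 1" and R: "nonexpansive R"
    and T: "T = (\<lambda>x. (1 - \<alpha>) *\<^sub>R x + \<alpha> *\<^sub>R R x)"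
    using assms by (auto simp: averaged_nonexpansive_def)
  have "norm (R u - R v) \<le> norm (u - v)"
    using R by (auto simp: nonexpansive_def lipschitz_on_def dist_norm)
  then have le: "\<alpha> * (norm (R u - R v))\<^sup>2 \<le> \<alpha> * (norm (u - v))\<^sup>2"
    using \<alpha> by (intro mult_left_mono power_mono) auto
  have Tuv: "T u - T v = (1 - \<alpha>) *\<^sub>R (u - v) + \<alpha> *\<^sub>R (R u - R v)"
    by (simp add: T algebra_simps)
  have res: "(u - T u) - (v - T v) = \<alpha> *\<^sub>R ((u - v) - (R u - R v))"
    by (simp add: T algebra_simps)
  have "(1 - \<alpha>) / \<alpha> * (norm ((u - T u) - (v - T v)))\<^sup>2
      = \<alpha> * (1 - \<alpha>) * (norm ((u - v) - (R u - R v)))\<^sup>2"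
    unfolding res using \<alpha> by (simp add: power_mult_distrib power2_eq_square)
  then show ?thesis
    using le unfolding Tuv norm_sq_affine_combination by (simp add: algebra_simps)
qed

lemma averaged_nonexpansive_norm_le:
  assumes "averaged_nonexpansive \<alpha> T"
  shows "norm (T u - T v) \<le> norm (u - v)"
proof -
  have "(1 - \<alpha>) / \<alpha> * (norm ((u - T u) - (v - T v)))\<^sup>2 \<ge> 0"
    using assms by (auto simp: averaged_nonexpansive_def)
  then have "(norm (T u - T v))\<^sup>2 \<le> (norm (u - v))\<^sup>2"
    using averaged_nonexpansive_norm_sq_le[OF assms, of u v] by linarith
  then show ?thesis by (rule power2_le_imp_le) simp
qed

text \<open>Relaxing \<open>T\<close> by \<open>l\<close> is the same as relaxing the underlying quasinonexpansive operator, called \<open>R\<close>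
in the proof, by \<open>l * \<phi>\<close>; the two operators have the same fixed points.\<close>

lemma averaged_quasinonexpansive_relaxation_norm_sq_le:
  assumes T: "averaged_quasinonexpansive \<phi> T" and y: "y \<in> Fix T" and "0 \<le> l"
  shows "(norm (z + l *\<^sub>R (T z - z) - y))\<^sup>2
    \<le> (norm (z - y))\<^sup>2 - l * (1 / \<phi> - l) * (norm (T z - z))\<^sup>2"
proof -
  define R where "R x = (1 - 1 / \<phi>) *\<^sub>R x + (1 / \<phi>) *\<^sub>R T x" for x
  have \<phi>: "0 < \<phi>" "\<phi> \<le> 1" and R: "quasinonexpansive R"
    using T by (auto simp: averaged_quasinonexpansive_def R_def[abs_def])
  have res: "R z - z = (1 / \<phi>) *\<^sub>R (T z - z)"
    by (simp add: R_def algebra_simps)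
  have "y \<in> Fix R"
    using y by (simp add: Fix_def R_def flip: scaleR_add_left)
  then have "norm (R z - y) \<le> norm (z - y)"
    using R by (simp add: quasinonexpansive_def)
  then have le: "(l * \<phi>) * (norm (R z - y))\<^sup>2 \<le> (l * \<phi>) * (norm (z - y))\<^sup>2"
    using \<phi> \<open>0 \<le> l\<close> by (intro mult_left_mono power_mono) auto
  have "(l * \<phi>) *\<^sub>R (R z - z) = l *\<^sub>R (T z - z)"
    using \<phi> by (simp add: res)
  then have relax: "z + l *\<^sub>R (T z - z) - y = (1 - l * \<phi>) *\<^sub>R (z - y) + (l * \<phi>) *\<^sub>R (R z - y)"
    by (simp add: algebra_simps)
  have "(norm ((z - y) - (R z - y)))\<^sup>2 = (1 / \<phi>)\<^sup>2 * (norm (T z - z))\<^sup>2"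
    using arg_cong[OF res, of norm] \<phi>
    by (simp add: norm_minus_commute power_mult_distrib power_divide)
  then have "(l * \<phi>) * (1 - l * \<phi>) * (norm ((z - y) - (R z - y)))\<^sup>2
      = l * (1 / \<phi> - l) * (norm (T z - z))\<^sup>2"
    using \<phi> by (simp add: divide_simps) (simp add: algebra_simps power2_eq_square)
  then show ?thesis
    using le unfolding relax norm_sq_affine_combination by (simp add: algebra_simps)
qed

text \<open>Against a fixed point, an averaged quasinonexpansive operator satisfies the inequality that
\<open>averaged_nonexpansive_norm_sq_le\<close> has for all pairs of points.  It is stated in the same
form, with \<open>T y\<close> in place of \<open>y\<close>, so that both kinds of operators can be chained.\<close>

lemma averaged_quasinonexpansive_norm_sq_le:
  assumes "averaged_quasinonexpansive \<alpha> T" and y: "y \<in> Fix T"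
  shows "(norm (T z - T y))\<^sup>2
    \<le> (norm (z - y))\<^sup>2 - (1 - \<alpha>) / \<alpha> * (norm ((z - T z) - (y - T y)))\<^sup>2"
proof -
  have "\<alpha> > 0" using assms(1) by (simp add: averaged_quasinonexpansive_def)
  then show ?thesis
    using averaged_quasinonexpansive_relaxation_norm_sq_le[OF assms, of 1 z] y
    by (simp add: Fix_def norm_minus_commute diff_divide_distrib)
qed

lemma compose_ops_rec: "p \<le> q \<Longrightarrow> compose_ops T p q = T p \<circ> compose_ops T (Suc p) q"
  unfolding compose_ops_def by (subst upt_conv_Cons) (auto simp del: upt_Suc)

lemma compose_ops_empty: "compose_ops T (Suc q) q = id"
  by (simp add: compose_ops_def)

lemma compose_ops_single: "compose_ops T q q = T q"
  by (simp add: compose_ops_rec compose_ops_empty)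

text \<open>The outer factors do not increase distances, so the composition cannot separate two points
by more than the innermost factor does.\<close>

lemma compose_ops_nonexpansive_outer:
  assumes "p \<le> q"
    and "\<And>i u v. p \<le> i \<Longrightarrow> i < q \<Longrightarrow> norm (T i u - T i v) \<le> norm (u - v)"
  shows "norm (compose_ops T p q u - compose_ops T p q v) \<le> norm (T q u - T q v)"
  using assms
proof (induction p rule: inc_induct)
  case base
  show ?case by (simp add: compose_ops_single)
next
  case (step p)
  have "norm (compose_ops T p q u - compose_ops T p q v)
      \<le> norm (compose_ops T (Suc p) q u - compose_ops T (Suc p) q v)"
    using step by (simp add: compose_ops_rec)
  also have "\<dots> \<le> norm (T q u - T q v)" using step by simp
  finally show ?case .
qed

text \<open>The error \<open>e i\<close> enters after \<open>T i\<close> has been applied and is only passed through \<open>T (i - 1), \<dots>, T 1\<close>.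
Thus no error ever goes through the innermost operator \<open>T m\<close>, which may well be discontinuous.\<close>

lemma perturbed_compose_error:
  assumes "m \<ge> 1"
    and "\<And>i u v. 1 \<le> i \<Longrightarrow> i < m \<Longrightarrow> norm (T i u - T i v) \<le> norm (u - v)"
  shows "norm (perturbed_compose T e m z - compose_ops T 1 m z) \<le> (\<Sum>i=1..m. norm (e i))"
proof -
  \<comment> \<open>The tail of the composition that starts at index \<open>p\<close> is compared first; the induction on \<open>p\<close>
     runs downwards from the innermost index \<open>m\<close>.\<close>
  have "norm (foldr (\<lambda>i z. T i z + e i) [p..<Suc m] z - compose_ops T p m z)
      \<le> (\<Sum>i=p..m. norm (e i))" if "p \<le> m" "1 \<le> p" for p
    using that
  proof (induction p rule: inc_induct)
    case base
    show ?case by (simp add: compose_ops_single)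
  next
    case (step p)
    let ?a = "foldr (\<lambda>i z. T i z + e i) [Suc p..<Suc m] z"
    let ?b = "compose_ops T (Suc p) m z"
    have "[p..<Suc m] = p # [Suc p..<Suc m]"
      using step by (simp add: upt_conv_Cons del: upt_Suc)
    then have "norm (foldr (\<lambda>i z. T i z + e i) [p..<Suc m] z - compose_ops T p m z)
        = norm ((T p ?a - T p ?b) + e p)"
      using step by (simp add: compose_ops_rec algebra_simps del: upt_Suc)
    also have "\<dots> \<le> norm (?a - ?b) + norm (e p)"
      using assms(2)[of p ?a ?b] step norm_triangle_ineq[of "T p ?a - T p ?b" "e p"] by simp
    also have "\<dots> \<le> (\<Sum>i=Suc p..m. norm (e i)) + norm (e p)" using step by simp
    also have "\<dots> = (\<Sum>i=p..m. norm (e i))" using step by (simp add: sum.atLeast_Suc_atMost)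
    finally show ?case .
  qed
  from this[OF assms(1) order_refl] show ?thesis unfolding perturbed_compose_def .
qed

text \<open>Telescoping: each factor, evaluated at the images of \<open>z\<close> and \<open>y\<close> under the factors inside it,
contributes its own decrease \<open>d i\<close>.\<close>

lemma compose_ops_norm_sq_le_sum:
  assumes "p \<le> Suc q"
    and "\<And>i. p \<le> i \<Longrightarrow> i \<le> q \<Longrightarrow>
      (norm (T i (compose_ops T (Suc i) q z) - T i (compose_ops T (Suc i) q y)))\<^sup>2
        \<le> (norm (compose_ops T (Suc i) q z - compose_ops T (Suc i) q y))\<^sup>2 - d i"
  shows "(norm (compose_ops T p q z - compose_ops T p q y))\<^sup>2
    \<le> (norm (z - y))\<^sup>2 - (\<Sum>i=p..q. d i)"
  using assms
proof (induction p rule: inc_induct)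
  case base
  show ?case by (simp add: compose_ops_empty)
next
  case (step p)
  have "(norm (compose_ops T p q z - compose_ops T p q y))\<^sup>2
      \<le> (norm (compose_ops T (Suc p) q z - compose_ops T (Suc p) q y))\<^sup>2 - d p"
    using step.prems[of p] step.hyps by (simp add: compose_ops_rec)
  also have "\<dots> \<le> (norm (z - y))\<^sup>2 - (\<Sum>i=Suc p..q. d i) - d p"
    using step by simp
  also have "\<dots> = (norm (z - y))\<^sup>2 - (\<Sum>i=p..q. d i)"
    using step by (simp add: sum.atLeast_Suc_atMost)
  finally show ?case .
qed

text \<open>A fixed point \<open>y\<close> of the composition keeps its distance to a common fixed point \<open>p\<close>, and the outer
factors cannot increase distances.  So \<open>T m\<close> does not bring \<open>y\<close> closer to \<open>p\<close>, which for
\<open>\<alpha> m < 1\<close> forces \<open>T m y = y\<close>.  The outer factors need not fix \<open>y\<close>, since their averaging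
constants may equal \<open>1\<close>.\<close>

lemma fixed_point_of_innermost:
  assumes "m \<ge> 1"
    and avg: "\<And>i. 1 \<le> i \<Longrightarrow> i < m \<Longrightarrow> averaged_nonexpansive (\<alpha> i) (T i)"
    and quasi: "averaged_quasinonexpansive (\<alpha> m) (T m)"
    and "\<alpha> m < 1"
    and p: "\<And>i. 1 \<le> i \<Longrightarrow> i \<le> m \<Longrightarrow> p \<in> Fix (T i)"
    and y: "y \<in> Fix (compose_ops T 1 m)"
  shows "y \<in> Fix (T m)"
proof -
  have pm: "p \<in> Fix (T m)" using p assms(1) by simp
  have "compose_ops T k m p = p" if "k \<le> m" "1 \<le> k" for k
    using that
    by (induction k rule: inc_induct)
      (use p assms(1) in \<open>auto simp: compose_ops_single compose_ops_rec Fix_def\<close>)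
  then have "norm (y - p) = norm (compose_ops T 1 m y - compose_ops T 1 m p)"
    using y assms(1) by (simp add: Fix_def)
  also have "\<dots> \<le> norm (T m y - T m p)"
    using assms(1) avg averaged_nonexpansive_norm_le by (intro compose_ops_nonexpansive_outer) blast+
  finally have "(norm (y - p))\<^sup>2 \<le> (norm (T m y - T m p))\<^sup>2" by (intro power_mono) auto
  with averaged_quasinonexpansive_norm_sq_le[OF quasi pm, of y]
  have "(1 - \<alpha> m) / \<alpha> m * (norm ((y - T m y) - (p - T m p)))\<^sup>2 \<le> 0" by linarith
  moreover have "(1 - \<alpha> m) / \<alpha> m > 0"
    using quasi assms(4) by (simp add: averaged_quasinonexpansive_def)
  ultimately have "(norm ((y - T m y) - (p - T m p)))\<^sup>2 \<le> 0"
    by (meson mult_pos_pos not_le)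
  then show ?thesis using pm by (simp add: Fix_def)
qed

text \<open>The decreases of the factors add up, and the maximum of nonnegative numbers is at most their sum.
The alternative on \<open>T m\<close> provides the inequality of the innermost factor between \<open>z\<close> and \<open>y\<close>: it
holds for arbitrary points in the first case and at a fixed point in the second.\<close>

lemma compose_ops_norm_sq_le_Max:
  assumes "m \<ge> 1"
    and avg: "\<And>i. 1 \<le> i \<Longrightarrow> i < m \<Longrightarrow> averaged_nonexpansive (\<alpha> i) (T i)"
    and quasi: "averaged_quasinonexpansive (\<alpha> m) (T m)"
    and inner: "averaged_nonexpansive (\<alpha> m) (T m) \<or> y \<in> Fix (T m)"
    and y: "y \<in> Fix (compose_ops T 1 m)"
  defines "C \<equiv> \<lambda>i. compose_ops T (Suc i) m"
  shows "(norm (compose_ops T 1 m z - y))\<^sup>2 \<le> (norm (z - y))\<^sup>2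
    - (MAX i\<in>{1..m}. (1 - \<alpha> i) / \<alpha> i *
        (norm ((C i z - T i (C i z)) - (C i y - T i (C i y))))\<^sup>2)"
proof -
  define d where "d i = (1 - \<alpha> i) / \<alpha> i * (norm ((C i z - T i (C i z)) - (C i y - T i (C i y))))\<^sup>2" for i
  have \<alpha>: "0 < \<alpha> i \<and> \<alpha> i \<le> 1" if "1 \<le> i" "i \<le> m" for i
    using avg[of i] quasi that
    by (cases "i < m") (auto simp: averaged_nonexpansive_def averaged_quasinonexpansive_def)
  have "(norm (T i (C i z) - T i (C i y)))\<^sup>2 \<le> (norm (C i z - C i y))\<^sup>2 - d i"
    if i: "1 \<le> i" "i \<le> m" for i
  proof (cases "i < m \<or> averaged_nonexpansive (\<alpha> m) (T m)")
    case True
    then have "averaged_nonexpansive (\<alpha> i) (T i)"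
      using avg i by (cases "i = m") auto
    then show ?thesis unfolding d_def by (rule averaged_nonexpansive_norm_sq_le)
  next
    case False
    then have "i = m" "y \<in> Fix (T m)" using i inner by auto
    then show ?thesis
      using averaged_quasinonexpansive_norm_sq_le[OF quasi, of y z]
      by (simp add: d_def C_def compose_ops_empty)
  qed
  then have "(norm (compose_ops T 1 m z - compose_ops T 1 m y))\<^sup>2
      \<le> (norm (z - y))\<^sup>2 - (\<Sum>i=1..m. d i)"
    using assms(1) unfolding C_def by (intro compose_ops_norm_sq_le_sum) auto
  moreover have "d i \<ge> 0" if "i \<in> {1..m}" for i
    using \<alpha>[of i] that by (simp add: d_def)
  then have "(MAX i\<in>{1..m}. d i) \<le> (\<Sum>i=1..m. d i)"
    using assms(1) by (intro Max.boundedI) (auto intro: member_le_sum)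
  ultimately show ?thesis using y unfolding d_def by (simp add: Fix_def)
qed

lemma weighted_summable_imp_tendsto_0:
  fixes w \<epsilon> :: "nat \<Rightarrow> real"
  assumes "summable (\<lambda>n. w n * \<epsilon> n)" "\<And>n. \<epsilon> n \<ge> 0" "\<And>n. w n > 0" "(INF n. w n) > 0"
  shows "\<epsilon> \<longlonglongrightarrow> 0"
proof -
  define c where "c = (INF n. w n)"
  have "c > 0" using assms(4) by (simp add: c_def)
  have "c \<le> w n" for n
    unfolding c_def using assms(3) by (intro cINF_lower bdd_belowI[of _ 0]) (auto intro: less_imp_le)
  then have "\<epsilon> n \<le> w n * \<epsilon> n / c" for n
    using mult_right_mono[OF _ assms(2)[of n], of c "w n"] \<open>c > 0\<close> by (simp add: field_simps)
  moreover have lim: "(\<lambda>n. w n * \<epsilon> n / c) \<longlonglongrightarrow> 0"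
    using tendsto_divide[OF summable_LIMSEQ_zero[OF assms(1)] tendsto_const[of c]] \<open>c > 0\<close> by simp
  ultimately show ?thesis
    using assms(2) by (intro tendsto_sandwich[OF _ _ tendsto_const lim] always_eventually allI)
qed

section \<open>The iteration on affine averages of its orbit\<close>

theorem theorem3p1:
  fixes m :: nat
    and \<alpha> :: "nat \<Rightarrow> nat \<Rightarrow> real"
    and T :: "nat \<Rightarrow> nat \<Rightarrow> 'a::{real_inner, complete_space} \<Rightarrow> 'a"
    and Tn :: "nat \<Rightarrow> 'a \<Rightarrow> 'a"
    and Tplus :: "nat \<Rightarrow> nat \<Rightarrow> 'a \<Rightarrow> 'a"
    and S :: "'a set"
    and \<phi> lam :: "nat \<Rightarrow> real"
    and e :: "nat \<Rightarrow> nat \<Rightarrow> 'a"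
    and \<mu> :: "nat \<Rightarrow> nat \<Rightarrow> real"
    and chi :: "nat \<Rightarrow> real"
    and x xbar :: "nat \<Rightarrow> 'a"
    and \<theta> :: "nat \<Rightarrow> real"
    and \<nu> :: "nat \<Rightarrow> 'a \<Rightarrow> real"
  assumes m: "m \<ge> 1"
    and \<alpha>: "\<forall>n. \<forall>i\<in>{1..m}. 0 < \<alpha> i n \<and> \<alpha> i n \<le> 1"
    and T_lt: "\<forall>n. \<forall>i\<in>{1..<m}. averaged_nonexpansive (\<alpha> i n) (T i n)"
    and T_m: "\<forall>n. averaged_quasinonexpansive (\<alpha> m n) (T m n)"
    and Tn: "\<forall>n. Tn n = compose_ops (\<lambda>i. T i n) 1 m"
    and S: "S = (\<Inter>n. Fix (Tn n))"
    and S_nonempty: "S \<noteq> {}"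
    and P: "(\<forall>n. averaged_nonexpansive (\<alpha> m n) (T m n))
          \<or> (m > 1 \<and> (\<forall>n. \<alpha> m n < 1 \<and> (\<Inter>i\<in>{1..m}. Fix (T i n)) \<noteq> {}))
          \<or> m = 1"
    and \<phi>: "\<forall>n. 0 < \<phi> n \<and> \<phi> n \<le> 1 \<and> averaged_quasinonexpansive (\<phi> n) (Tn n)"
    and lam: "\<forall>n. 0 < lam n \<and> lam n \<le> 1 / \<phi> n"
    and A1: "bdd_above (range (\<lambda>n. \<Sum>j=0..n. \<bar>\<mu> n j\<bar>))"
    and A2: "\<forall>n. (\<Sum>j=0..n. \<mu> n j) = 1"
    and A3: "\<forall>j. (\<lambda>n. \<mu> n j) \<longlonglongrightarrow> 0"
    and A4: "\<forall>n. chi n > 0" "(INF n. chi n) > 0"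
      "\<forall>\<xi>::nat \<Rightarrow> real. (\<forall>n. \<xi> n \<ge> 0) \<longrightarrow>
         (\<exists>\<epsilon>::nat \<Rightarrow> real. (\<forall>n. \<epsilon> n \<ge> 0) \<and> summable (\<lambda>n. chi n * \<epsilon> n) \<and>
            (\<forall>n. \<xi> (Suc n) \<le> (\<Sum>j=0..n. \<mu> n j * \<xi> j) + \<epsilon> n)) \<longrightarrow>
         convergent \<xi>"
    and xbar: "\<forall>n. xbar n = (\<Sum>j=0..n. \<mu> n j *\<^sub>R x j)"
    and x_Suc: "\<forall>n. x (Suc n) = xbar n +
          lam n *\<^sub>R (perturbed_compose (\<lambda>i. T i n) (\<lambda>i. e i n) m (xbar n) - xbar n)"
    and \<theta>: "\<forall>n. \<theta> n = lam n * (\<Sum>i=1..m. norm (e i n))"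
    and Tplus: "\<forall>n. \<forall>i\<in>{1..m}. Tplus i n =
          (if i = m then id else compose_ops (\<lambda>k. T k n) (i + 1) m)"
    and \<nu>: "\<forall>n. \<forall>y\<in>S. \<nu> n y = \<theta> n * (2 * norm (xbar n - y) + \<theta> n)"
  shows
    "(\<forall>n. \<forall>y\<in>S. norm (x (Suc n) - y) \<le> (\<Sum>j=0..n. \<bar>\<mu> n j\<bar> * norm (x j - y)) + \<theta> n)
   \<and> (\<forall>n. \<forall>y\<in>S. (norm (x (Suc n) - y))\<^sup>2
        \<le> (\<Sum>j=0..n. \<mu> n j * (norm (x j - y))\<^sup>2)
          - 1 / 2 * (\<Sum>j=0..n. \<Sum>k=0..n. \<mu> n j * \<mu> n k * (norm (x j - x k))\<^sup>2)
          - lam n * (1 / \<phi> n - lam n) * (norm (Tn n (xbar n) - xbar n))\<^sup>2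
          + \<nu> n y)
   \<and> (\<forall>n. \<forall>y\<in>S. (norm (x (Suc n) - y))\<^sup>2
        \<le> (\<Sum>j=0..n. \<mu> n j * (norm (x j - y))\<^sup>2)
          - 1 / 2 * (\<Sum>j=0..n. \<Sum>k=0..n. \<mu> n j * \<mu> n k * (norm (x j - x k))\<^sup>2)
          + lam n * (lam n - 1) * (norm (Tn n (xbar n) - xbar n))\<^sup>2
          - lam n * (MAX i\<in>{1..m}. (1 - \<alpha> i n) / \<alpha> i n *
              (norm ((Tplus i n (xbar n) - T i n (Tplus i n (xbar n)))
                   - (Tplus i n y - T i n (Tplus i n y))))\<^sup>2)
          + \<nu> n y)
   \<and> (summable (\<lambda>n. chi n * (\<Sum>j=0..n. \<Sum>k=0..n.
                  neg_part (\<mu> n j * \<mu> n k) * (norm (x j - x k))\<^sup>2))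
      \<and> (\<forall>y\<in>S. summable (\<lambda>n. chi n * \<nu> n y)) \<longrightarrow>
        (\<forall>y\<in>S. convergent (\<lambda>n. norm (x n - y)))
      \<and> (\<lambda>n. lam n * (1 / \<phi> n - lam n) * (norm (Tn n (xbar n) - xbar n))\<^sup>2) \<longlonglongrightarrow> 0
      \<and> (\<lambda>n. \<Sum>j=0..n. \<Sum>k=0..n.
            pos_part (\<mu> n j * \<mu> n k) * (norm (x j - x k))\<^sup>2) \<longlonglongrightarrow> 0
      \<and> ((\<exists>\<epsilon>. 0 < \<epsilon> \<and> \<epsilon> < 1 \<and> (\<forall>n. lam n \<le> (1 - \<epsilon>) / \<phi> n)) \<longrightarrow>
            (\<lambda>n. x (Suc n) - xbar n) \<longlonglongrightarrow> 0
          \<and> ((\<forall>y. weak_sequential_cluster_point xbar y \<longrightarrow> y \<in> S) \<longrightarrow>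
               (\<exists>y\<in>S. weakly_converges x y)))
      \<and> (\<forall>y\<in>S. strong_cluster_point xbar y
            \<and> (\<exists>\<epsilon>. 0 < \<epsilon> \<and> \<epsilon> < 1 \<and> (\<forall>n. lam n \<le> (1 - \<epsilon>) / \<phi> n)) \<longrightarrow>
            x \<longlonglongrightarrow> y)
      \<and> (\<forall>y\<in>S. (\<exists>\<epsilon>. 0 < \<epsilon> \<and> \<epsilon> < 1 \<and> (\<forall>n. lam n \<le> \<epsilon> + (1 - \<epsilon>) / \<phi> n)) \<longrightarrow>
            (\<lambda>n. lam n * (MAX i\<in>{1..m}. (1 - \<alpha> i n) / \<alpha> i n *
              (norm ((Tplus i n (xbar n) - T i n (Tplus i n (xbar n)))
                   - (Tplus i n y - T i n (Tplus i n y))))\<^sup>2)) \<longlonglongrightarrow> 0))"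
proof -
  \<comment> \<open>\<open>w\<close> is the error-free update, \<open>res\<close> and \<open>gap\<close> are the two kinds of gain of a step, and \<open>Q\<close>
     is twice the variance of the averaged iterates, split into \<open>Qp\<close> and \<open>Qn\<close> by the sign of the
     products of weights.\<close>
  define w where "w n = xbar n + lam n *\<^sub>R (Tn n (xbar n) - xbar n)" for n
  define gap where "gap n y = (MAX i\<in>{1..m}. (1 - \<alpha> i n) / \<alpha> i n *
      (norm ((Tplus i n (xbar n) - T i n (Tplus i n (xbar n)))
           - (Tplus i n y - T i n (Tplus i n y))))\<^sup>2)" for n y
  define Q where "Q n = (\<Sum>j=0..n. \<Sum>k=0..n. \<mu> n j * \<mu> n k * (norm (x j - x k))\<^sup>2)" for n
  define Qp where "Qp n = (\<Sum>j=0..n. \<Sum>k=0..n. pos_part (\<mu> n j * \<mu> n k) * (norm (x j - x k))\<^sup>2)" for n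
  define Qn where "Qn n = (\<Sum>j=0..n. \<Sum>k=0..n. neg_part (\<mu> n j * \<mu> n k) * (norm (x j - x k))\<^sup>2)" for n
  define mean where "mean n y = (\<Sum>j=0..n. \<mu> n j * (norm (x j - y))\<^sup>2)" for n y
  define res where "res n = lam n * (1 / \<phi> n - lam n) * (norm (Tn n (xbar n) - xbar n))\<^sup>2" for n

  have avg: "averaged_nonexpansive (\<alpha> i n) (T i n)" if "1 \<le> i" "i < m" for i n
    using T_lt that by auto
  have quasi: "averaged_quasinonexpansive (\<alpha> m n) (T m n)" for n
    using T_m by blast
  have \<phi>_pos: "\<phi> n > 0" and Tn_quasi: "averaged_quasinonexpansive (\<phi> n) (Tn n)" for n
    using \<phi> by auto
  have lam_pos: "lam n > 0" and lam_le: "lam n \<le> 1 / \<phi> n" for n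
    using lam by auto
  have S_Fix: "y \<in> Fix (Tn n)" if "y \<in> S" for y n
    using that S by blast
  have \<theta>_nonneg: "\<theta> n \<ge> 0" for n
    using \<theta> lam_pos[of n] by (simp add: sum_nonneg)
  have \<nu>_nonneg: "\<nu> n y \<ge> 0" if "y \<in> S" for n y
    using \<nu> that \<theta>_nonneg[of n] by simp
  have res_nonneg: "res n \<ge> 0" for n
    using lam_pos[of n] lam_le[of n] by (simp add: res_def)

  have x_w: "norm (x (Suc n) - w n) \<le> \<theta> n" for n
  proof -
    let ?p = "perturbed_compose (\<lambda>i. T i n) (\<lambda>i. e i n) m (xbar n)"
    have "norm (?p - Tn n (xbar n)) \<le> (\<Sum>i=1..m. norm (e i n))"
      using perturbed_compose_error[OF m, of "\<lambda>i. T i n" "\<lambda>i. e i n" "xbar n"]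
        averaged_nonexpansive_norm_le[OF avg] Tn by simp
    then have "lam n * norm (?p - Tn n (xbar n)) \<le> \<theta> n"
      using \<theta> lam_pos[of n] by simp
    moreover have "x (Suc n) - w n = lam n *\<^sub>R (?p - Tn n (xbar n))"
      using x_Suc by (simp add: w_def algebra_simps)
    ultimately show ?thesis using lam_pos[of n] by simp
  qed
  have relax: "(norm (w n - y))\<^sup>2 \<le> (norm (xbar n - y))\<^sup>2 - res n" if "y \<in> S" for n y
    using averaged_quasinonexpansive_relaxation_norm_sq_le[OF Tn_quasi S_Fix[OF that]] lam_pos[of n]
    by (simp add: w_def res_def)
  have w_le: "norm (w n - y) \<le> norm (xbar n - y)" if "y \<in> S" for n y
  proof (rule power2_le_imp_le)
    show "(norm (w n - y))\<^sup>2 \<le> (norm (xbar n - y))\<^sup>2"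
      using relax[OF that, of n] res_nonneg[of n] by linarith
  qed simp
  have step: "(norm (x (Suc n) - y))\<^sup>2 \<le> (norm (w n - y))\<^sup>2 + \<nu> n y" if "y \<in> S" for n y
  proof -
    have "norm (x (Suc n) - y) \<le> norm (w n - y) + \<theta> n"
      using norm_triangle_ineq[of "x (Suc n) - w n" "w n - y"] x_w[of n] by simp
    then have "(norm (x (Suc n) - y))\<^sup>2 \<le> (norm (w n - y) + \<theta> n)\<^sup>2"
      by (intro power_mono) auto
    also have "\<dots> = (norm (w n - y))\<^sup>2 + \<theta> n * (2 * norm (w n - y) + \<theta> n)"
      by (simp add: power2_eq_square algebra_simps)
    also have "\<dots> \<le> (norm (w n - y))\<^sup>2 + \<theta> n * (2 * norm (xbar n - y) + \<theta> n)"
      using w_le[OF that, of n] \<theta>_nonneg[of n] by (intro add_left_mono mult_left_mono) auto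
    finally show ?thesis using \<nu> that by simp
  qed
  have xbar_sq: "(norm (xbar n - y))\<^sup>2 = mean n y - 1 / 2 * Q n" for n y
    using norm_sq_affine_sum[of "\<mu> n" "{0..n}" x y] A2 xbar by (simp add: mean_def Q_def)
  have gap_le: "(norm (Tn n (xbar n) - y))\<^sup>2 \<le> (norm (xbar n - y))\<^sup>2 - gap n y" if "y \<in> S" for n y
  proof -
    have y: "y \<in> Fix (compose_ops (\<lambda>i. T i n) 1 m)" using S_Fix[OF that, of n] Tn by simp
    \<comment> \<open>This is where the three alternatives on the operators enter.\<close>
    have inner: "averaged_nonexpansive (\<alpha> m n) (T m n) \<or> y \<in> Fix (T m n)"
      using P
    proof (elim disjE conjE)
      assume "\<forall>n. averaged_nonexpansive (\<alpha> m n) (T m n)"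
      then show ?thesis by blast
    next
      assume "\<forall>n. \<alpha> m n < 1 \<and> (\<Inter>i\<in>{1..m}. Fix (T i n)) \<noteq> {}"
      then obtain p where "\<alpha> m n < 1" "p \<in> (\<Inter>i\<in>{1..m}. Fix (T i n))" by blast
      then have "y \<in> Fix (T m n)"
        using avg quasi m y by (intro fixed_point_of_innermost[of m "\<lambda>i. \<alpha> i n" "\<lambda>i. T i n" p]) auto
      then show ?thesis by blast
    next
      assume "m = 1"
      then show ?thesis using y by (simp add: compose_ops_single del: One_nat_def)
    qed
    have Tplus_eq: "Tplus i n = compose_ops (\<lambda>i. T i n) (Suc i) m" if "i \<in> {1..m}" for i
      using Tplus that by (auto simp: compose_ops_empty)
    show ?thesis
      using compose_ops_norm_sq_le_Max[OF m avg quasi inner y, of "xbar n"] Tn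
      by (simp add: gap_def Tplus_eq)
  qed
  have gap_nonneg: "gap n y \<ge> 0" for n y
  proof -
    have "0 < \<alpha> 1 n \<and> \<alpha> 1 n \<le> 1" using \<alpha> m by (simp del: One_nat_def)
    then have "0 \<le> (1 - \<alpha> 1 n) / \<alpha> 1 n * (norm ((Tplus 1 n (xbar n) - T 1 n (Tplus 1 n (xbar n)))
        - (Tplus 1 n y - T 1 n (Tplus 1 n y))))\<^sup>2"
      by (intro mult_nonneg_nonneg divide_nonneg_nonneg) auto
    also have "\<dots> \<le> gap n y"
      unfolding gap_def using m by (intro Max_ge) auto
    finally show ?thesis .
  qed

  have norm_bound: "norm (x (Suc n) - y) \<le> (\<Sum>j=0..n. \<bar>\<mu> n j\<bar> * norm (x j - y)) + \<theta> n" if "y \<in> S" for n y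
  proof -
    have "xbar n - y = (\<Sum>j=0..n. \<mu> n j *\<^sub>R (x j - y))"
      using xbar A2 by (simp add: scaleR_diff_right sum_subtractf flip: scaleR_left.sum)
    then have "norm (xbar n - y) \<le> (\<Sum>j=0..n. \<bar>\<mu> n j\<bar> * norm (x j - y))"
      using norm_sum[of "\<lambda>j. \<mu> n j *\<^sub>R (x j - y)" "{0..n}"] by simp
    then show ?thesis
      using norm_triangle_ineq[of "x (Suc n) - w n" "w n - y"] x_w[of n] w_le[OF that, of n] by simp
  qed
  have residual_bound: "(norm (x (Suc n) - y))\<^sup>2 \<le> mean n y - 1 / 2 * Q n - res n + \<nu> n y" if "y \<in> S" for n y
    using step[OF that, of n] relax[OF that, of n] xbar_sq[of n y] by simp
  have gap_bound: "(norm (x (Suc n) - y))\<^sup>2 \<le> mean n y - 1 / 2 * Q n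
      + lam n * (lam n - 1) * (norm (Tn n (xbar n) - xbar n))\<^sup>2 - lam n * gap n y + \<nu> n y"
    if "y \<in> S" for n y
  proof -
    have w_eq: "w n - y = (1 - lam n) *\<^sub>R (xbar n - y) + lam n *\<^sub>R (Tn n (xbar n) - y)"
      by (simp add: w_def algebra_simps)
    have diff_eq: "(xbar n - y) - (Tn n (xbar n) - y) = xbar n - Tn n (xbar n)" by simp
    have "(norm (w n - y))\<^sup>2 = (1 - lam n) * (norm (xbar n - y))\<^sup>2
        + lam n * (norm (Tn n (xbar n) - y))\<^sup>2
        + lam n * (lam n - 1) * (norm (Tn n (xbar n) - xbar n))\<^sup>2"
      unfolding w_eq norm_sq_affine_combination diff_eq norm_minus_commute[of "xbar n" "Tn n (xbar n)"]
      by (simp add: left_diff_distrib right_diff_distrib)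
    moreover have "lam n * (norm (Tn n (xbar n) - y))\<^sup>2 \<le> lam n * ((norm (xbar n - y))\<^sup>2 - gap n y)"
      using gap_le[OF that, of n] lam_pos[of n] by (intro mult_left_mono) auto
    ultimately have "(norm (w n - y))\<^sup>2 \<le> (norm (xbar n - y))\<^sup>2 - lam n * gap n y
        + lam n * (lam n - 1) * (norm (Tn n (xbar n) - xbar n))\<^sup>2"
      by (simp only: left_diff_distrib right_diff_distrib mult_1_left)
    then show ?thesis
      using step[OF that, of n] unfolding xbar_sq by linarith
  qed

  have asymptotic: "(\<forall>y\<in>S. convergent (\<lambda>n. norm (x n - y)))
      \<and> res \<longlonglongrightarrow> 0
      \<and> Qp \<longlonglongrightarrow> 0
      \<and> ((\<exists>\<epsilon>. 0 < \<epsilon> \<and> \<epsilon> < 1 \<and> (\<forall>n. lam n \<le> (1 - \<epsilon>) / \<phi> n)) \<longrightarrow>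
            (\<lambda>n. x (Suc n) - xbar n) \<longlonglongrightarrow> 0
          \<and> ((\<forall>y. weak_sequential_cluster_point xbar y \<longrightarrow> y \<in> S) \<longrightarrow>
               (\<exists>y\<in>S. weakly_converges x y)))
      \<and> (\<forall>y\<in>S. strong_cluster_point xbar y
            \<and> (\<exists>\<epsilon>. 0 < \<epsilon> \<and> \<epsilon> < 1 \<and> (\<forall>n. lam n \<le> (1 - \<epsilon>) / \<phi> n)) \<longrightarrow>
            x \<longlonglongrightarrow> y)
      \<and> (\<forall>y\<in>S. (\<exists>\<epsilon>. 0 < \<epsilon> \<and> \<epsilon> < 1 \<and> (\<forall>n. lam n \<le> \<epsilon> + (1 - \<epsilon>) / \<phi> n)) \<longrightarrow>
            (\<lambda>n. lam n * gap n y) \<longlonglongrightarrow> 0)"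
    if sum_Qn: "summable (\<lambda>n. chi n * Qn n)" and sum_\<nu>: "\<forall>y\<in>S. summable (\<lambda>n. chi n * \<nu> n y)"
  proof -
    have "neg_part t \<ge> 0" "pos_part t \<ge> 0" for t
      by (auto simp: pos_part_def neg_part_def)
    then have Qn_nonneg: "Qn n \<ge> 0" and Qp_nonneg: "Qp n \<ge> 0" for n
      unfolding Qn_def Qp_def by (auto intro!: sum_nonneg mult_nonneg_nonneg)
    have "pos_part t - neg_part t = t" for t
      by (auto simp: pos_part_def neg_part_def)
    then have "Q n = Qp n - Qn n" for n
      by (simp add: Q_def Qp_def Qn_def flip: sum_subtractf left_diff_distrib)
    then have Q_split: "1 / 2 * Q n = 1 / 2 * Qp n - 1 / 2 * Qn n" for n
      by (simp only: right_diff_distrib)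
    \<comment> \<open>The part of the variance with negative weights acts as an additional error.\<close>
    define \<epsilon> where "\<epsilon> n y = 1 / 2 * Qn n + \<nu> n y" for n y
    have \<epsilon>_nonneg: "\<epsilon> n y \<ge> 0" if "y \<in> S" for n y
      using Qn_nonneg[of n] \<nu>_nonneg[OF that, of n] by (simp add: \<epsilon>_def)
    have \<epsilon>_summable: "summable (\<lambda>n. chi n * \<epsilon> n y)" if "y \<in> S" for y
    proof -
      have "summable (\<lambda>n. 1 / 2 * (chi n * Qn n) + chi n * \<nu> n y)"
        using sum_Qn sum_\<nu> that by (intro summable_add summable_mult) auto
      then show ?thesis by (simp add: \<epsilon>_def algebra_simps)
    qed
    have \<epsilon>_lim: "(\<lambda>n. \<epsilon> n y) \<longlonglongrightarrow> 0" if "y \<in> S" for y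
      using A4(1,2) \<epsilon>_nonneg[OF that]
      by (intro weighted_summable_imp_tendsto_0[OF \<epsilon>_summable[OF that]]) auto
    \<comment> \<open>The convergence hypothesis is applied to the squared distances: for them the weights keep
       their signs, while the bound on the distances themselves involves \<open>\<bar>\<mu> n j\<bar>\<close>.\<close>
    have \<xi>_conv: "convergent (\<lambda>n. (norm (x n - y))\<^sup>2)" if "y \<in> S" for y
    proof (rule A4(3)[rule_format])
      show "\<exists>\<epsilon>'. (\<forall>n. 0 \<le> \<epsilon>' n) \<and> summable (\<lambda>n. chi n * \<epsilon>' n)
          \<and> (\<forall>n. (norm (x (Suc n) - y))\<^sup>2 \<le> (\<Sum>j=0..n. \<mu> n j * (norm (x j - y))\<^sup>2) + \<epsilon>' n)"
      proof (intro exI[of _ "\<lambda>n. \<epsilon> n y"] conjI allI)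
        fix n
        have "(norm (x (Suc n) - y))\<^sup>2 \<le> mean n y + \<epsilon> n y"
          using residual_bound[OF that, of n] res_nonneg[of n] Qp_nonneg[of n]
          unfolding \<epsilon>_def Q_split by linarith
        then show "(norm (x (Suc n) - y))\<^sup>2 \<le> (\<Sum>j=0..n. \<mu> n j * (norm (x j - y))\<^sup>2) + \<epsilon> n y"
          unfolding mean_def .
      qed (use \<epsilon>_nonneg \<epsilon>_summable that in auto)
    qed simp
    have dist_conv: "convergent (\<lambda>n. norm (x n - y))" if y: "y \<in> S" for y
    proof -
      obtain l where "(\<lambda>n. (norm (x n - y))\<^sup>2) \<longlonglongrightarrow> l"
        using \<xi>_conv[OF y] by (auto simp: convergent_def)
      then have "(\<lambda>n. sqrt ((norm (x n - y))\<^sup>2)) \<longlonglongrightarrow> sqrt l" by (rule tendsto_real_sqrt)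
      then show ?thesis by (auto simp: convergent_def)
    qed
    have residual: "r \<longlonglongrightarrow> 0"
      if "y \<in> S" "\<delta> \<longlonglongrightarrow> 0" "\<And>n. r n \<ge> 0"
        "\<And>n. (norm (x (Suc n) - y))\<^sup>2 \<le> mean n y - r n + \<delta> n" for r \<delta> :: "nat \<Rightarrow> real" and y
      by (rule residual_tendsto_0[OF A1 _ _ \<xi>_conv[OF that(1)] that(2,3)])
        (use A2 A3 that(4) in \<open>auto simp: mean_def\<close>)
    obtain s where s: "s \<in> S" using S_nonempty by blast
    have res_lim: "res \<longlonglongrightarrow> 0"
    proof (rule residual[OF s \<epsilon>_lim[OF s] res_nonneg])
      show "(norm (x (Suc n) - s))\<^sup>2 \<le> mean n s - res n + \<epsilon> n s" for n
        using residual_bound[OF s, of n] Qp_nonneg[of n] unfolding \<epsilon>_def Q_split by linarith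
    qed
    have "(\<lambda>n. 1 / 2 * Qp n) \<longlonglongrightarrow> 0"
    proof (rule residual[OF s \<epsilon>_lim[OF s]])
      show "(norm (x (Suc n) - s))\<^sup>2 \<le> mean n s - 1 / 2 * Qp n + \<epsilon> n s" for n
        using residual_bound[OF s, of n] res_nonneg[of n] unfolding \<epsilon>_def Q_split by linarith
    qed (use Qp_nonneg in auto)
    then have Qp_lim: "Qp \<longlonglongrightarrow> 0"
      using tendsto_mult_left[of "\<lambda>n. 1 / 2 * Qp n" 0 sequentially 2] by simp
    have \<theta>_lim: "\<theta> \<longlonglongrightarrow> 0"
    proof -
      have lim: "(\<lambda>n. \<nu> n s) \<longlonglongrightarrow> 0"
        using A4(1,2) \<nu>_nonneg[OF s] sum_\<nu> s by (intro weighted_summable_imp_tendsto_0[of chi]) auto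
      \<comment> \<open>The perturbations vanish because \<open>\<nu>\<close> dominates their squares.\<close>
      have "(\<theta> n)\<^sup>2 \<le> \<nu> n s" for n
        using \<nu> s \<theta>_nonneg[of n] by (simp add: power2_eq_square algebra_simps)
      then have "(\<lambda>n. (\<theta> n)\<^sup>2) \<longlonglongrightarrow> 0"
        by (intro Lim_null_comparison[OF _ lim] always_eventually allI) simp
      then show ?thesis by simp
    qed
    have increment_lim: "(\<lambda>n. x (Suc n) - xbar n) \<longlonglongrightarrow> 0"
      if \<epsilon>: "0 < \<epsilon>" "\<epsilon> < 1" "\<forall>n. lam n \<le> (1 - \<epsilon>) / \<phi> n" for \<epsilon>
    proof -
      have bound: "(lam n * norm (Tn n (xbar n) - xbar n))\<^sup>2 \<le> res n / \<epsilon>" for n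
      proof -
        have "\<epsilon> * lam n \<le> \<epsilon> / \<phi> n"
          using mult_left_mono[OF lam_le[of n], of \<epsilon>] \<epsilon> by simp
        also have "\<dots> \<le> 1 / \<phi> n - lam n"
          using \<epsilon>(3) by (simp add: diff_divide_distrib algebra_simps)
        finally have "lam n * (\<epsilon> * lam n) * (norm (Tn n (xbar n) - xbar n))\<^sup>2 \<le> res n"
          unfolding res_def using lam_pos[of n] by (intro mult_right_mono mult_left_mono) auto
        then show ?thesis using \<epsilon>(1) by (simp add: field_simps power2_eq_square)
      qed
      have lim: "(\<lambda>n. res n / \<epsilon>) \<longlonglongrightarrow> 0"
        using tendsto_divide[OF res_lim tendsto_const[of \<epsilon>]] \<epsilon>(1) by simp
      have "(\<lambda>n. (lam n * norm (Tn n (xbar n) - xbar n))\<^sup>2) \<longlonglongrightarrow> 0"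
        using bound by (intro Lim_null_comparison[OF _ lim] always_eventually allI) simp
      then have "(\<lambda>n. lam n * norm (Tn n (xbar n) - xbar n)) \<longlonglongrightarrow> 0" by simp
      from tendsto_add[OF \<theta>_lim this]
      have lim: "(\<lambda>n. \<theta> n + lam n * norm (Tn n (xbar n) - xbar n)) \<longlonglongrightarrow> 0" by simp
      have "norm (x (Suc n) - xbar n) \<le> \<theta> n + lam n * norm (Tn n (xbar n) - xbar n)" for n
        using norm_triangle_ineq[of "x (Suc n) - w n" "w n - xbar n"] x_w[of n] lam_pos[of n]
        by (simp add: w_def)
      then show ?thesis by (intro Lim_null_comparison[OF _ lim] always_eventually allI)
    qed
    have weak_lim: "\<exists>y\<in>S. weakly_converges x y"
      if diff: "(\<lambda>n. x (Suc n) - xbar n) \<longlonglongrightarrow> 0"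
        and clus: "\<forall>y. weak_sequential_cluster_point xbar y \<longrightarrow> y \<in> S"
    proof -
      \<comment> \<open>Opial's argument is applied to the shifted sequence: a cluster point of \<open>x (Suc n)\<close> is one of
         \<open>xbar\<close> along the same subsequence, whereas \<open>x n\<close> would require shifting the indices.\<close>
      have clus_Suc: "y \<in> S" if y: "weak_sequential_cluster_point (\<lambda>n. x (Suc n)) y" for y
      proof -
        obtain r where r: "strict_mono r" "weakly_converges ((\<lambda>n. x (Suc n)) \<circ> r) y"
          using y by (auto simp: weak_sequential_cluster_point_def)
        have "(\<lambda>k. xbar (r k) \<bullet> u) \<longlonglongrightarrow> y \<bullet> u" for u
        proof -
          have "(\<lambda>k. (x (Suc (r k)) - xbar (r k)) \<bullet> u) \<longlonglongrightarrow> 0 \<bullet> u"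
            using LIMSEQ_subseq_LIMSEQ[OF diff r(1)] by (intro tendsto_intros) (simp add: o_def)
          moreover have "(\<lambda>k. x (Suc (r k)) \<bullet> u) \<longlonglongrightarrow> y \<bullet> u"
            using r(2) by (simp add: weakly_converges_def)
          ultimately have "(\<lambda>k. x (Suc (r k)) \<bullet> u - (x (Suc (r k)) - xbar (r k)) \<bullet> u) \<longlonglongrightarrow> y \<bullet> u - 0 \<bullet> u"
            by (intro tendsto_diff)
          then show ?thesis by (simp add: inner_diff_left)
        qed
        then have "weak_sequential_cluster_point xbar y"
          using r(1) by (auto simp: weak_sequential_cluster_point_def weakly_converges_def)
        then show ?thesis using clus by blast
      qed
      have conv_Suc: "convergent (\<lambda>n. norm (x (Suc n) - y))" if "y \<in> S" for y
        using dist_conv[OF that] by (subst convergent_Suc_iff)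
      obtain y where y: "y \<in> S" "weakly_converges (\<lambda>n. x (Suc n)) y"
        using opial[OF S_nonempty, of "\<lambda>n. x (Suc n)"] conv_Suc clus_Suc by metis
      have "(\<lambda>n. x n \<bullet> u) \<longlonglongrightarrow> y \<bullet> u" for u
        by (rule LIMSEQ_imp_Suc) (use y(2) in \<open>simp add: weakly_converges_def\<close>)
      then show ?thesis using y(1) by (auto simp: weakly_converges_def)
    qed
    have strong_lim: "x \<longlonglongrightarrow> y"
      if y: "y \<in> S" "strong_cluster_point xbar y" and diff: "(\<lambda>n. x (Suc n) - xbar n) \<longlonglongrightarrow> 0" for y
    proof -
      obtain r where r: "strict_mono r" "(xbar \<circ> r) \<longlonglongrightarrow> y"
        using y(2) by (auto simp: strong_cluster_point_def)
      obtain l where l: "(\<lambda>n. norm (x n - y)) \<longlonglongrightarrow> l"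
        using dist_conv[OF y(1)] by (auto simp: convergent_def)
      have "(\<lambda>k. (x (Suc (r k)) - xbar (r k)) + xbar (r k)) \<longlonglongrightarrow> 0 + y"
        using LIMSEQ_subseq_LIMSEQ[OF diff r(1)] r(2) by (intro tendsto_add) (simp_all add: o_def)
      then have "(\<lambda>k. norm (x (Suc (r k)) - y)) \<longlonglongrightarrow> norm (y - y)"
        by (intro tendsto_intros) simp
      moreover have "(\<lambda>k. norm (x (Suc (r k)) - y)) \<longlonglongrightarrow> l"
        using LIMSEQ_subseq_LIMSEQ[OF LIMSEQ_Suc[OF l] r(1)] by (simp add: o_def)
      ultimately have "l = 0" using LIMSEQ_unique by fastforce
      then show ?thesis using l by (simp add: LIM_zero_iff tendsto_norm_zero_iff)
    qed
    have gap_lim: "(\<lambda>n. lam n * gap n y) \<longlonglongrightarrow> 0"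
      if y: "y \<in> S" and \<eta>: "0 < \<eta>" "\<eta> < 1" "\<forall>n. lam n \<le> \<eta> + (1 - \<eta>) / \<phi> n" for y \<eta>
    proof (rule residual[OF y])
      show "(\<lambda>n. \<epsilon> n y + (1 - \<eta>) / \<eta> * res n) \<longlonglongrightarrow> 0"
        using tendsto_add[OF \<epsilon>_lim[OF y] tendsto_mult_left[OF res_lim, of "(1 - \<eta>) / \<eta>"]] by simp
      show "0 \<le> lam n * gap n y" for n using lam_pos[of n] gap_nonneg[of n y] by simp
      fix n
      \<comment> \<open>For \<open>lam n > 1\<close> the term \<open>lam n * (lam n - 1)\<close> is a loss.  The bound on \<open>lam n\<close> makes it at
         most a fixed multiple of the residual gain, which is already known to vanish.\<close>
      have "\<eta> * (lam n - 1) \<le> (1 - \<eta>) * (1 / \<phi> n - lam n)"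
        using \<eta>(3) by (simp add: algebra_simps diff_divide_distrib)
      then have "lam n - 1 \<le> (1 - \<eta>) / \<eta> * (1 / \<phi> n - lam n)"
        using \<eta>(1) by (simp add: pos_le_divide_eq mult.commute)
      then have "lam n * (lam n - 1) * (norm (Tn n (xbar n) - xbar n))\<^sup>2
          \<le> lam n * ((1 - \<eta>) / \<eta> * (1 / \<phi> n - lam n)) * (norm (Tn n (xbar n) - xbar n))\<^sup>2"
        using lam_pos[of n] by (intro mult_right_mono mult_left_mono) auto
      also have "\<dots> = (1 - \<eta>) / \<eta> * res n" by (simp add: res_def)
      finally show "(norm (x (Suc n) - y))\<^sup>2
          \<le> mean n y - lam n * gap n y + (\<epsilon> n y + (1 - \<eta>) / \<eta> * res n)"
        using gap_bound[OF y, of n] Qp_nonneg[of n] unfolding \<epsilon>_def Q_split by linarith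
    qed
    show ?thesis
      using dist_conv res_lim Qp_lim increment_lim weak_lim strong_lim gap_lim by blast
  qed

  show ?thesis
  proof (rule conjI[OF _ conjI[OF _ conjI]], goal_cases)
    case 1
    show ?case using norm_bound by blast
  next
    case 2
    show ?case using residual_bound unfolding mean_def Q_def res_def by blast
  next
    case 3
    show ?case using gap_bound unfolding mean_def Q_def gap_def by blast
  next
    case 4
    show ?case
    proof (rule impI, elim conjE, goal_cases)
      case 1
      from asymptotic[unfolded Qn_def[abs_def] Qp_def[abs_def] res_def[abs_def] gap_def[abs_def], OF this]
      show ?case .
    qed
  qed
qed

end
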